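(* Given sets of correct and faulty servers, $\mathbf{V}_{\mathrm{ok}}$ and $\mathbf{V}_{\mathrm{bad}}$, let $\{\mathcal{S}_v\}_{v\in\mathbf{V}_{\mathrm{ok}}}$ be a subjective federated Byzantine quorum system with quorum intersection where at least one server is intact. Let $(\{\mathcal{Q}_v\}_{v\in\mathbf{V}_{\mathrm{ok}}},\{\mathcal{B}_v\}_{v\in\mathbf{V}_{\mathrm{ok}}})$ be the subjective dissemination quorum system that it induces. Then Bracha broadcast over this subjective dissemination quorum system implements reliable Byzantine broadcast (Validity, No duplication, Integrity, Consistency and Totality).
   Context: System model. There is a set of clients $\mathbf{C}$ and a disjoint finite non-empty set of servers $\mathbf{V}=\mathbf{V}_{\mathrm{ok}}\uplus\mathbf{V}_{\mathrm{bad}}$, with $\mathbf{V}_{\mathrm{ok}}$ the correct and $\mathbf{V}_{\mathrm{bad}}$ the faulty servers. Correct nodes follow their protocol; faulty (Byzantine) nodes behave arbitrarily. One distinguished client $c$ is the sender; it may be correct or faulty. Any two nodes communicate over an asynchronous point-to-point channel. If both endpoints are correct, the channel is authenticated and reliable: a correct node receives (eventually, after an arbitrary finite delay) a message from another correct node if and only if the latter sent it. Servers also send messages to themselves. Executions are complete: a handler of a correct server that stays enabled is eventually executed. A correct sender broadcasts at most one value. Federated Byzantine quorum system (FBQS) over $\mathbf{V}$: a function $\mathcal{S}$ assigning to each $v\in\mathbf{V}$ a non-empty set $\mathcal{S}(v)\subseteq 2^{\mathbf{V}}$ of quorum slices, with $v\in q$ for all $q\in\mathcal{S}(v)$. A non-empty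 $U\subseteq\mathbf{V}$ is a quorum in $\mathcal{S}$ if $\forall v\in U.\ \exists q\in\mathcal{S}(v).\ q\subseteq U$. $\mathcal{S}$ has quorum intersection if any two of its quorums intersect. For $I\subseteq\mathbf{V}$, $\mathcal{S}|_I$ is the FBQS over universe $I$ with $\mathcal{S}|_I(v)=\{q\cap I\mid q\in\mathcal{S}(v)\}$. Given a set $F\subseteq\mathbf{V}$ of faulty servers, the set of intact servers in $\mathcal{S}$ is the biggest set $I$ such that $I\cap F=\emptyset$; if $I$ is non-empty then it is a quorum in $\mathcal{S}$; and $\mathcal{S}|_I$ has quorum intersection. (For FBQSes with quorum intersection this set exists and is unique.) Subjective FBQS: a family $\{\mathcal{S}_v\}_{v\in\mathbf{V}_{\mathrm{ok}}}$ of FBQSes over $\mathbf{V}$ such that $\mathcal{S}_{v_1}(v)=\mathcal{S}_{v_2}(v)$ for all $v_1,v_2,v\in\mathbf{V}_{\mathrm{ok}}$. It has quorum intersection if every $\mathcal{S}_v$ does. The set of intact servers in the subjective FBQS is the biggest set $\mathbf{V}_{\mathrm{int}}$ such that $\mathbf{V}_{\mathrm{int}}\cap\mathbf{V}_{\mathrm{bad}}=\emptyset$; if $\mathbf{V}_{\mathrm{int}}$ is non-empty then it is a quorum in $\mathcal{S}_v$ for each $v\in\mathbf{V}_{\mathrm{ok}}$; and $\mathcal{S}_v|_{\mathbf{V}_{\mathrm{int}}}$ has quorum intersection for each $v\in\mathbf{V}_{\mathrm{ok}}$. Induced subjective dissemination quorum system: for each $v\in\mathbf{V}_{\mathrm{ok}}$,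 $\mathcal{Q}_v$ is the set of quorums in $\mathcal{S}_v$, and $\mathcal{B}_v$ consists of the inclusion-maximal sets $B\subseteq\mathbf{V}$ such that the set of intact servers in the FBQS $\mathcal{S}_v$ with set of faulty servers $B$ is non-empty. (A subjective dissemination quorum system is a family of quorum systems $\mathcal{Q}_v$ and fail-prone systems $\mathcal{B}_v$ such that for all $v\in\mathbf{V}_{\mathrm{ok}}$: some $B\in\mathcal{B}_v$ contains $\mathbf{V}_{\mathrm{bad}}$; for all $U_1\in\mathcal{Q}_v$, $U_2\in\bigcup_{v'\in\mathbf{V}_{\mathrm{ok}}}\mathcal{Q}_{v'}$ and $B\in\mathcal{B}_v$ with $\mathbf{V}_{\mathrm{bad}}\subseteq B$, $U_1\cap U_2\not\subseteq B$; and for all $B\in\mathcal{B}_v$ there is $U\in\mathcal{Q}_v$ with $U\cap B=\emptyset$.) Bracha broadcast over the subjective system (each correct server acts according to its own view). To broadcast a value $a$, the sender $c$ sends $\mathtt{BCAST}(a)$ to every server. Each correct server $v$ has Boolean variables echoed, ready, delivered, all initially false, and the following handlers. (1) When $v$ has received $\mathtt{BCAST}(a)$ from $c$ and echoed is false: set echoed to true and send $\mathtt{ECHO}(a)$ to every server. (2) When $v$ has received $\mathtt{ECHO}(a)$ from every $u\in U$ for some $U\in\mathcal{Q}_v$, and ready is false: set ready to true and send $\mathtt{READY}(a)$ to every server. (3) When $v$ has received $\mathtt{READY}(a)$ from every $u\in B$ for some non-empty $B\subseteq\mathbf{V}$ such that $B\not\subseteq B'$ for all $B'\in\mathcal{B}_v$,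 and ready is false: set ready to true and send $\mathtt{READY}(a)$ to every server. (4) When $v$ has received $\mathtt{READY}(a)$ from every $u\in U$ for some $U\in\mathcal{Q}_v$, and delivered is false: set delivered to true and deliver $a$. Reliable Byzantine broadcast. Validity: if the sender is correct and broadcasts a value $a$, then every correct server eventually delivers $a$. No duplication: every correct server delivers at most one value. Integrity: if some correct server delivers a value $a$ and the sender is correct, then $a$ was previously broadcast by the sender. Consistency: if some correct server delivers $a$ and another correct server delivers $a'$, then $a=a'$. Totality: if a correct server delivers a value, then every correct server eventually delivers a value. *)

theory Defs
  imports Main
begin

definition fbqs :: "'n set \<Rightarrow> ('n \<Rightarrow> 'n set set) \<Rightarrow> bool" where
  "fbqs V S \<longleftrightarrow> (\<forall>v\<in>V. S v \<noteq> {} \<and> (\<forall>q\<in>S v. q \<subseteq> V \<and> v \<in> q))"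

definition quorum :: "'n set \<Rightarrow> ('n \<Rightarrow> 'n set set) \<Rightarrow> 'n set \<Rightarrow> bool" where
  "quorum V S U \<longleftrightarrow> U \<noteq> {} \<and> U \<subseteq> V \<and> (\<forall>v\<in>U. \<exists>q\<in>S v. q \<subseteq> U)"

definition quorum_intersection :: "'n set \<Rightarrow> ('n \<Rightarrow> 'n set set) \<Rightarrow> bool" where
  "quorum_intersection V S \<longleftrightarrow>
     (\<forall>U1 U2. quorum V S U1 \<and> quorum V S U2 \<longrightarrow> U1 \<inter> U2 \<noteq> {})"

text \<open>The restricted slices are to be read over the universe \<open>I\<close>: only the values at servers
  in \<open>I\<close> matter.\<close>

definition restrict_slices :: "('n \<Rightarrow> 'n set set) \<Rightarrow> 'n set \<Rightarrow> 'n \<Rightarrow> 'n set set" where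
  "restrict_slices S I v = {q \<inter> I | q. q \<in> S v}"

text \<open>\<open>GREATEST\<close> is with respect to inclusion. The greatest set exists whenever \<open>V\<close> is finite and
  the system has quorum intersection, and is unspecified if there is none.\<close>

definition intact :: "'n set \<Rightarrow> ('n \<Rightarrow> 'n set set) \<Rightarrow> 'n set \<Rightarrow> 'n set" where
  "intact V S F = (GREATEST I.
     I \<subseteq> V \<and> I \<inter> F = {} \<and>
     (I \<noteq> {} \<longrightarrow> quorum V S I) \<and>
     quorum_intersection I (restrict_slices S I))"

text \<open>\<open>S v\<close> is the view of server \<open>v\<close>: \<open>S v u\<close> are the slices which \<open>v\<close> believes \<open>u\<close> to have.
  Views are indexed by the correct servers; values at other indices are irrelevant.\<close>

definition subjective_fbqs :: "'n set \<Rightarrow> 'n set \<Rightarrow> ('n \<Rightarrow> 'n \<Rightarrow> 'n set set) \<Rightarrow> bool" where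
  "subjective_fbqs Vok Vbad S \<longleftrightarrow>
     (\<forall>v\<in>Vok. fbqs (Vok \<union> Vbad) (S v)) \<and>
     (\<forall>v1\<in>Vok. \<forall>v2\<in>Vok. \<forall>v\<in>Vok. S v1 v = S v2 v)"

definition subjective_quorum_intersection ::
    "'n set \<Rightarrow> 'n set \<Rightarrow> ('n \<Rightarrow> 'n \<Rightarrow> 'n set set) \<Rightarrow> bool" where
  "subjective_quorum_intersection Vok Vbad S \<longleftrightarrow>
     (\<forall>v\<in>Vok. quorum_intersection (Vok \<union> Vbad) (S v))"

definition subjective_intact :: "'n set \<Rightarrow> 'n set \<Rightarrow> ('n \<Rightarrow> 'n \<Rightarrow> 'n set set) \<Rightarrow> 'n set" where
  "subjective_intact Vok Vbad S = (GREATEST I.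
     I \<subseteq> Vok \<union> Vbad \<and> I \<inter> Vbad = {} \<and>
     (I \<noteq> {} \<longrightarrow> (\<forall>v\<in>Vok. quorum (Vok \<union> Vbad) (S v) I)) \<and>
     (\<forall>v\<in>Vok. quorum_intersection I (restrict_slices (S v) I)))"

definition induced_quorums :: "'n set \<Rightarrow> ('n \<Rightarrow> 'n set set) \<Rightarrow> 'n set set" where
  "induced_quorums V S = {U. quorum V S U}"

definition induced_fail_prone :: "'n set \<Rightarrow> ('n \<Rightarrow> 'n set set) \<Rightarrow> 'n set set" where
  "induced_fail_prone V S =
     {B. B \<subseteq> V \<and> intact V S B \<noteq> {} \<and>
         (\<forall>B'. B' \<subseteq> V \<and> intact V S B' \<noteq> {} \<and> B \<subseteq> B' \<longrightarrow> B' = B)}"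

datatype 'a msg = BCAST 'a | ECHO 'a | READY 'a

text \<open>\<open>(u, w, m) \<in> sent s\<close>: the correct node \<open>u\<close> has sent \<open>m\<close> to \<open>w\<close>.
  \<open>(u, m) \<in> received s v\<close>: the correct server \<open>v\<close> has received \<open>m\<close> over its channel with \<open>u\<close>.
  Nothing is recorded about the state of faulty nodes.\<close>

record ('n, 'a) config =
  has_bcast :: bool
  echoed :: "'n \<Rightarrow> bool"
  ready :: "'n \<Rightarrow> bool"
  delivered :: "'n \<Rightarrow> bool"
  sent :: "('n \<times> 'n \<times> 'a msg) set"
  received :: "'n \<Rightarrow> ('n \<times> 'a msg) set"

definition initial_config :: "('n, 'a) config" where
  "initial_config =
     \<lparr> has_bcast = False, echoed = (\<lambda>_. False), ready = (\<lambda>_. False), delivered = (\<lambda>_. False),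
       sent = {}, received = (\<lambda>_. {}) \<rparr>"

definition send_all ::
    "'n set \<Rightarrow> 'n \<Rightarrow> 'a msg \<Rightarrow> ('n \<times> 'n \<times> 'a msg) set \<Rightarrow> ('n \<times> 'n \<times> 'a msg) set" where
  "send_all V u m X = X \<union> {(u, w, m) | w. w \<in> V}"

text \<open>\<open>Broadcast\<close> is performed by the sender if it is correct. \<open>Receive u v m\<close> is the receipt by
  \<open>v\<close> of \<open>m\<close> from \<open>u\<close>. \<open>Idle\<close> lets an infinite sequence represent an execution in which only
  finitely many steps happen.\<close>

datatype ('n, 'a) action =
    Broadcast 'a
  | Receive 'n 'n "'a msg"
  | Echo 'n 'a
  | ReadyFromEcho 'n 'a
  | ReadyFromReady 'n 'a
  | Deliver 'n 'a
  | Idle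

text \<open>Correct nodes are \<open>Cok \<union> Vok\<close>. A message from a faulty node can be received at any time,
  whatever its contents, so faulty nodes need no actions of their own.\<close>

fun enabled ::
    "'n set \<Rightarrow> 'n set \<Rightarrow> 'n set \<Rightarrow> 'n set \<Rightarrow> 'n \<Rightarrow> ('n \<Rightarrow> 'n set set) \<Rightarrow> ('n \<Rightarrow> 'n set set) \<Rightarrow>
     ('n, 'a) config \<Rightarrow> ('n, 'a) action \<Rightarrow> bool" where
  "enabled C Cok Vok Vbad c Q B s (Broadcast a) \<longleftrightarrow> c \<in> Cok \<and> \<not> has_bcast s"
| "enabled C Cok Vok Vbad c Q B s (Receive u v m) \<longleftrightarrow>
     v \<in> Vok \<and> u \<in> C \<union> Vok \<union> Vbad \<and> (u \<in> Cok \<union> Vok \<longrightarrow> (u, v, m) \<in> sent s)"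
| "enabled C Cok Vok Vbad c Q B s (Echo v a) \<longleftrightarrow>
     v \<in> Vok \<and> \<not> echoed s v \<and> (c, BCAST a) \<in> received s v"
| "enabled C Cok Vok Vbad c Q B s (ReadyFromEcho v a) \<longleftrightarrow>
     v \<in> Vok \<and> \<not> ready s v \<and> (\<exists>U\<in>Q v. \<forall>u\<in>U. (u, ECHO a) \<in> received s v)"
| "enabled C Cok Vok Vbad c Q B s (ReadyFromReady v a) \<longleftrightarrow>
     v \<in> Vok \<and> \<not> ready s v \<and>
     (\<exists>W. W \<noteq> {} \<and> W \<subseteq> Vok \<union> Vbad \<and> (\<forall>B'\<in>B v. \<not> W \<subseteq> B') \<and>
          (\<forall>u\<in>W. (u, READY a) \<in> received s v))"
| "enabled C Cok Vok Vbad c Q B s (Deliver v a) \<longleftrightarrow>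
     v \<in> Vok \<and> \<not> delivered s v \<and> (\<exists>U\<in>Q v. \<forall>u\<in>U. (u, READY a) \<in> received s v)"
| "enabled C Cok Vok Vbad c Q B s Idle \<longleftrightarrow> True"

fun perform :: "'n set \<Rightarrow> 'n \<Rightarrow> ('n, 'a) action \<Rightarrow> ('n, 'a) config \<Rightarrow> ('n, 'a) config" where
  "perform V c (Broadcast a) s =
     s\<lparr> has_bcast := True, sent := send_all V c (BCAST a) (sent s) \<rparr>"
| "perform V c (Receive u v m) s =
     s\<lparr> received := (received s)(v := insert (u, m) (received s v)) \<rparr>"
| "perform V c (Echo v a) s =
     s\<lparr> echoed := (echoed s)(v := True), sent := send_all V v (ECHO a) (sent s) \<rparr>"
| "perform V c (ReadyFromEcho v a) s =
     s\<lparr> ready := (ready s)(v := True), sent := send_all V v (READY a) (sent s) \<rparr>"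
| "perform V c (ReadyFromReady v a) s =
     s\<lparr> ready := (ready s)(v := True), sent := send_all V v (READY a) (sent s) \<rparr>"
| "perform V c (Deliver v a) s = s\<lparr> delivered := (delivered s)(v := True) \<rparr>"
| "perform V c Idle s = s"

definition handlers :: "'n set \<Rightarrow> ('n, 'a) action set" where
  "handlers Vok =
     (\<Union>v\<in>Vok. \<Union>a. {Echo v a, ReadyFromEcho v a, ReadyFromReady v a, Deliver v a})"

text \<open>A complete execution, with configurations \<open>\<sigma>\<close> and actions \<open>\<alpha>\<close>. The last two conjuncts are
  reliability of the channels between correct nodes and completeness: a handler that stays enabled
  is eventually executed.\<close>

definition bracha_execution ::
    "'n set \<Rightarrow> 'n set \<Rightarrow> 'n set \<Rightarrow> 'n set \<Rightarrow> 'n \<Rightarrow> ('n \<Rightarrow> 'n set set) \<Rightarrow> ('n \<Rightarrow> 'n set set) \<Rightarrow>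
     (nat \<Rightarrow> ('n, 'a) config) \<Rightarrow> (nat \<Rightarrow> ('n, 'a) action) \<Rightarrow> bool" where
  "bracha_execution C Cok Vok Vbad c Q B \<sigma> \<alpha> \<longleftrightarrow>
     \<sigma> 0 = initial_config \<and>
     (\<forall>t. enabled C Cok Vok Vbad c Q B (\<sigma> t) (\<alpha> t) \<and>
          \<sigma> (Suc t) = perform (Vok \<union> Vbad) c (\<alpha> t) (\<sigma> t)) \<and>
     (\<forall>t. \<forall>u\<in>Cok \<union> Vok. \<forall>v\<in>Vok. \<forall>m.
          (u, v, m) \<in> sent (\<sigma> t) \<longrightarrow> (\<exists>t'. (u, m) \<in> received (\<sigma> t') v)) \<and>
     (\<forall>h\<in>handlers Vok. \<forall>t.
          (\<forall>t'\<ge>t. enabled C Cok Vok Vbad c Q B (\<sigma> t') h) \<longrightarrow> (\<exists>t'\<ge>t. \<alpha> t' = h))"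

definition bracha_traces ::
    "'n set \<Rightarrow> 'n set \<Rightarrow> 'n set \<Rightarrow> 'n set \<Rightarrow> 'n \<Rightarrow> ('n \<Rightarrow> 'n set set) \<Rightarrow> ('n \<Rightarrow> 'n set set) \<Rightarrow>
     (nat \<Rightarrow> ('n, 'a) action) set" where
  "bracha_traces C Cok Vok Vbad c Q B = {\<alpha>. \<exists>\<sigma>. bracha_execution C Cok Vok Vbad c Q B \<sigma> \<alpha>}"

definition validity :: "'n set \<Rightarrow> 'n set \<Rightarrow> 'n \<Rightarrow> (nat \<Rightarrow> ('n, 'a) action) \<Rightarrow> bool" where
  "validity Cok Vok c \<alpha> \<longleftrightarrow>
     (c \<in> Cok \<longrightarrow> (\<forall>t a. \<alpha> t = Broadcast a \<longrightarrow> (\<forall>v\<in>Vok. \<exists>t'>t. \<alpha> t' = Deliver v a)))"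

text \<open>At most one delivery takes place at each server, so in particular at most one value is
  delivered.\<close>

definition no_duplication :: "'n set \<Rightarrow> (nat \<Rightarrow> ('n, 'a) action) \<Rightarrow> bool" where
  "no_duplication Vok \<alpha> \<longleftrightarrow>
     (\<forall>v\<in>Vok. \<forall>t t' a a'. \<alpha> t = Deliver v a \<and> \<alpha> t' = Deliver v a' \<longrightarrow> t = t' \<and> a = a')"

definition integrity :: "'n set \<Rightarrow> 'n set \<Rightarrow> 'n \<Rightarrow> (nat \<Rightarrow> ('n, 'a) action) \<Rightarrow> bool" where
  "integrity Cok Vok c \<alpha> \<longleftrightarrow>
     (\<forall>v\<in>Vok. \<forall>t a. \<alpha> t = Deliver v a \<and> c \<in> Cok \<longrightarrow> (\<exists>t'<t. \<alpha> t' = Broadcast a))"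

definition consistency :: "'n set \<Rightarrow> (nat \<Rightarrow> ('n, 'a) action) \<Rightarrow> bool" where
  "consistency Vok \<alpha> \<longleftrightarrow>
     (\<forall>v\<in>Vok. \<forall>v'\<in>Vok. \<forall>t t' a a'. \<alpha> t = Deliver v a \<and> \<alpha> t' = Deliver v' a' \<longrightarrow> a = a')"

definition totality :: "'n set \<Rightarrow> (nat \<Rightarrow> ('n, 'a) action) \<Rightarrow> bool" where
  "totality Vok \<alpha> \<longleftrightarrow>
     (\<forall>v\<in>Vok. \<forall>t a. \<alpha> t = Deliver v a \<longrightarrow> (\<forall>v'\<in>Vok. \<exists>t' a'. \<alpha> t' = Deliver v' a'))"

definition implements_reliable_byzantine_broadcast ::
    "'n set \<Rightarrow> 'n set \<Rightarrow> 'n \<Rightarrow> (nat \<Rightarrow> ('n, 'a) action) set \<Rightarrow> bool" where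
  "implements_reliable_byzantine_broadcast Cok Vok c T \<longleftrightarrow>
     (\<forall>\<alpha>\<in>T. validity Cok Vok c \<alpha> \<and> no_duplication Vok \<alpha> \<and> integrity Cok Vok c \<alpha> \<and>
             consistency Vok \<alpha> \<and> totality Vok \<alpha>)"

end

theory Submission
  imports Defs
begin

text \<open>Let \<open>I\<close> be the set of intact servers. In every view, any quorum meets \<open>I\<close> in a quorum of the
  view restricted to \<open>I\<close>, and all views agree on this restriction, which has quorum intersection.
  Hence any two quorums, even of different views, share an intact server. The members of a
  fail-prone system are complements of quorums, so for the same reason the correct part of a quorum
  of one view lies in no fail-prone set of any other view: once a quorum is ready at one correct
  server, every correct server is pushed into becoming ready. These two facts, together with the
  availability of \<open>I\<close> itself as a quorum, are all that Bracha's argument needs.\<close>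

section \<open>Intact servers\<close>

text \<open>\<open>V\<close> has finitely many subsets, so closure under binary unions carries over
  to the union of all sets satisfying \<open>P\<close>, which is then the greatest one. Both notions
  of intact set are \<open>GREATEST\<close> terms and get their properties from here.\<close>

lemma Greatest_Un_closed:
  assumes "finite V" and sub: "\<And>X. P X \<Longrightarrow> X \<subseteq> V" and empty: "P {}"
    and Un: "\<And>X Y. P X \<Longrightarrow> P Y \<Longrightarrow> P (X \<union> Y)"
  shows "P (GREATEST X. P X)" and "P X \<Longrightarrow> X \<subseteq> (GREATEST X. P X)"
proof -
  have "P (\<Union>\<X>)" if "finite \<X>" "\<X> \<subseteq> Collect P" for \<X>
    using that by (induction \<X> rule: finite_induct) (auto intro: empty Un)
  moreover have "finite (Collect P)"
    using assms(1) sub by (auto intro: finite_subset[of _ "Pow V"])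
  ultimately have P: "P (\<Union>(Collect P))"
    by blast
  then have eq: "(GREATEST X. P X) = \<Union>(Collect P)"
    by (intro Greatest_equality) auto
  show "P (GREATEST X. P X)"
    using P eq by simp
  show "P X \<Longrightarrow> X \<subseteq> (GREATEST X. P X)"
    using eq by auto
qed

text \<open>The non-empty candidates for the intact set, with disjointness from the faulty set split
  off so that the faulty set can vary.\<close>

definition intact_quorum :: "'n set \<Rightarrow> ('n \<Rightarrow> 'n set set) \<Rightarrow> 'n set \<Rightarrow> bool" where
  "intact_quorum V S I \<longleftrightarrow> quorum V S I \<and> quorum_intersection I (restrict_slices S I)"

section \<open>Quorums under unions and restrictions\<close>

lemma quorum_intersection_empty: "quorum_intersection {} S"
  by (auto simp: quorum_intersection_def quorum_def)

lemma quorum_Un: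
  assumes "quorum V S U" "quorum V S U'"
  shows "quorum V S (U \<union> U')"
  using assms unfolding quorum_def by (meson UnE Un_empty Un_least le_supI1 le_supI2)

lemma quorum_slice:
  assumes "quorum V S U" "v \<in> U"
  shows "\<exists>q\<in>S v. q \<inter> I \<subseteq> U"
  using assms unfolding quorum_def by (meson le_infI1)

text \<open>The premise asks only for slices that lie in \<open>U\<close> after being cut to
  \<open>I\<close>. Thus \<open>U\<close> may be a quorum of \<open>S\<close>, or merely of a
  restriction to a larger set than \<open>I\<close>.\<close>

lemma quorum_restrict:
  assumes "\<And>v. v \<in> U \<inter> I \<Longrightarrow> \<exists>q\<in>S v. q \<inter> I \<subseteq> U" and "U \<inter> I \<noteq> {}"
  shows "quorum I (restrict_slices S I) (U \<inter> I)"
  unfolding quorum_def restrict_slices_def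
proof (intro conjI ballI)
  fix v assume "v \<in> U \<inter> I"
  then obtain q where "q \<in> S v" "q \<inter> I \<subseteq> U"
    using assms(1) by blast
  then show "\<exists>q'\<in>{q \<inter> I |q. q \<in> S v}. q' \<subseteq> U \<inter> I"
    by (intro bexI[of _ "q \<inter> I"]) auto
qed (use assms(2) in auto)

text \<open>Restricting to \<open>I\<close> reads only slices of members of \<open>I\<close>, where
  the two views agree. Both quorums therefore leave traces in one restricted system, which has
  quorum intersection; the traces are non-empty because \<open>I\<close> is a quorum of each
  view.\<close>

lemma intact_quorum_meets:
  assumes I: "intact_quorum V S I" and "quorum_intersection V S"
    and S': "\<And>v. v \<in> I \<Longrightarrow> S' v = S v" and "quorum_intersection V S'"
    and U: "quorum V S U" and U': "quorum V S' U'"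
  shows "U \<inter> U' \<inter> I \<noteq> {}"
proof -
  have IS: "quorum V S I"
    using I by (simp add: intact_quorum_def)
  then have IS': "quorum V S' I"
    using S' by (simp add: quorum_def)
  have "quorum I (restrict_slices S I) (U \<inter> I)"
  proof (rule quorum_restrict)
    show "U \<inter> I \<noteq> {}"
      using IS U assms(2) unfolding quorum_intersection_def by blast
    show "\<exists>q\<in>S v. q \<inter> I \<subseteq> U" if "v \<in> U \<inter> I" for v
      using quorum_slice[OF U] that by blast
  qed
  moreover have "quorum I (restrict_slices S I) (U' \<inter> I)"
  proof (rule quorum_restrict)
    show "U' \<inter> I \<noteq> {}"
      using IS' U' assms(4) unfolding quorum_intersection_def by blast
    show "\<exists>q\<in>S v. q \<inter> I \<subseteq> U'" if "v \<in> U' \<inter> I" for v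
      using quorum_slice[OF U', of v] that S' by auto
  qed
  ultimately have "(U \<inter> I) \<inter> (U' \<inter> I) \<noteq> {}"
    using I unfolding intact_quorum_def quorum_intersection_def by blast
  then show ?thesis
    by blast
qed

text \<open>A quorum of the restriction to \<open>I \<union> J\<close> has as its trace on
  \<open>I\<close> a quorum of the restriction to \<open>I\<close>, so intersection is inherited
  from \<open>I\<close>. The delicate point is that this trace is non-empty.\<close>

lemma intact_quorum_Un:
  assumes I: "intact_quorum V S I" and J: "intact_quorum V S J" and qi: "quorum_intersection V S"
  shows "intact_quorum V S (I \<union> J)"
proof -
  have qI: "quorum V S I" and qJ: "quorum V S J"
    using I J by (auto simp: intact_quorum_def)
  have restr: "quorum I (restrict_slices S I) (U \<inter> I)"
    if U: "quorum (I \<union> J) (restrict_slices S (I \<union> J)) U" for U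
  proof -
    have slice: "\<exists>q\<in>S v. q \<inter> (I \<union> J) \<subseteq> U" if "v \<in> U" for v
      using U that unfolding quorum_def restrict_slices_def by blast
    have UIJ: "U \<subseteq> I \<union> J" "U \<noteq> {}"
      using U by (auto simp: quorum_def)
    have meet: "U \<inter> I \<noteq> {}"
    proof
      \<comment> \<open>Otherwise \<open>U\<close> and \<open>I \<inter> J\<close> would be disjoint quorums of the restriction to \<open>J\<close>.\<close>
      assume disj: "U \<inter> I = {}"
      then have UJ: "U \<inter> J \<noteq> {}"
        using UIJ by blast
      have "quorum J (restrict_slices S J) (U \<inter> J)"
      proof (rule quorum_restrict)
        show "\<exists>q\<in>S v. q \<inter> J \<subseteq> U" if "v \<in> U \<inter> J" for v
          using slice[of v] that by blast
      qed (rule UJ)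
      moreover have "quorum J (restrict_slices S J) (I \<inter> J)"
      proof (rule quorum_restrict)
        show "\<exists>q\<in>S v. q \<inter> J \<subseteq> I" if "v \<in> I \<inter> J" for v
          using quorum_slice[OF qI] that by blast
        show "I \<inter> J \<noteq> {}"
          using qi qI qJ by (simp add: quorum_intersection_def)
      qed
      ultimately have "(U \<inter> J) \<inter> (I \<inter> J) \<noteq> {}"
        using J unfolding intact_quorum_def quorum_intersection_def by blast
      then show False
        using disj by blast
    qed
    show "quorum I (restrict_slices S I) (U \<inter> I)"
    proof (rule quorum_restrict)
      show "\<exists>q\<in>S v. q \<inter> I \<subseteq> U" if "v \<in> U \<inter> I" for v
        using slice[of v] that by blast
    qed (rule meet)
  qed
  have "quorum_intersection (I \<union> J) (restrict_slices S (I \<union> J))"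
    unfolding quorum_intersection_def
  proof (intro allI impI)
    fix U U'
    assume "quorum (I \<union> J) (restrict_slices S (I \<union> J)) U \<and>
      quorum (I \<union> J) (restrict_slices S (I \<union> J)) U'"
    then have "(U \<inter> I) \<inter> (U' \<inter> I) \<noteq> {}"
      using restr I unfolding intact_quorum_def quorum_intersection_def by blast
    then show "U \<inter> U' \<noteq> {}"
      by blast
  qed
  then show ?thesis
    using quorum_Un[OF qI qJ] by (simp add: intact_quorum_def)
qed

text \<open>Candidates are closed under union and include the empty set, so the greatest candidate
  exists and contains every other one. Its non-emptiness thus amounts to one non-empty
  witness.\<close>

lemma intact_nonempty_iff:
  assumes "finite V" and qi: "quorum_intersection V S"
  shows "intact V S F \<noteq> {} \<longleftrightarrow> (\<exists>I. intact_quorum V S I \<and> I \<inter> F = {})"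
proof -
  let ?P = "\<lambda>I. I \<subseteq> V \<and> I \<inter> F = {} \<and> (I \<noteq> {} \<longrightarrow> quorum V S I) \<and>
    quorum_intersection I (restrict_slices S I)"
  have P_iff: "?P I \<longleftrightarrow> I = {} \<or> intact_quorum V S I \<and> I \<inter> F = {}" for I
    by (auto simp: intact_quorum_def quorum_intersection_empty quorum_def)
  have Un: "?P (X \<union> Y)" if "?P X" "?P Y" for X Y
    using that unfolding P_iff by (auto intro: intact_quorum_Un[OF _ _ qi])
  have empty: "?P {}"
    by (simp add: quorum_intersection_empty)
  have "?P (intact V S F)"
    unfolding intact_def
    by (rule Greatest_Un_closed(1)[where P = ?P, OF assms(1) _ empty Un]) blast+
  moreover have "X \<subseteq> intact V S F" if "?P X" for X
    unfolding intact_def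
    by (rule Greatest_Un_closed(2)[where P = ?P, OF assms(1) _ empty Un that]) blast+
  ultimately show ?thesis
    unfolding P_iff by (metis intact_quorum_def quorum_def subset_empty)
qed

section \<open>Induced fail-prone sets\<close>

lemma induced_fail_proneD:
  assumes "finite V" "quorum_intersection V S" and B: "B \<in> induced_fail_prone V S"
  obtains I where "intact_quorum V S I" "B = V - I"
proof -
  have "intact V S B \<noteq> {}" and "B \<subseteq> V"
    using B by (auto simp: induced_fail_prone_def)
  then obtain I where I: "intact_quorum V S I" "I \<inter> B = {}"
    using intact_nonempty_iff[OF assms(1,2)] by blast
  \<comment> \<open>The witness \<open>I\<close> for \<open>B\<close> also witnesses the larger
    faulty set \<open>V - I\<close>, so maximality of \<open>B\<close> forces equality.\<close>
  then have "intact V S (V - I) \<noteq> {}"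
    using intact_nonempty_iff[OF assms(1,2)] by blast
  moreover have "B \<subseteq> V - I"
    using I \<open>B \<subseteq> V\<close> by blast
  ultimately have "B = V - I"
    using B by (auto simp: induced_fail_prone_def)
  with I that show ?thesis
    by blast
qed

lemma ex_induced_fail_prone_superset:
  assumes "finite V" "quorum_intersection V S" "intact_quorum V S I"
  obtains B where "B \<in> induced_fail_prone V S" "V - I \<subseteq> B"
proof -
  let ?A = "{B. B \<subseteq> V \<and> intact V S B \<noteq> {}}"
  have "finite ?A"
    using assms(1) by simp
  moreover have "V - I \<in> ?A"
    using intact_nonempty_iff[OF assms(1,2)] assms(3) by blast
  ultimately obtain B where B: "B \<in> ?A" "V - I \<subseteq> B" "\<forall>B'\<in>?A. B \<subseteq> B' \<longrightarrow> B = B'"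
    by (metis (no_types, lifting) finite_has_maximal2)
  then have "B \<in> induced_fail_prone V S"
    unfolding induced_fail_prone_def by blast
  with B(2) that show ?thesis
    by blast
qed

lemma subjective_intact_props:
  assumes "finite (Vok \<union> Vbad)" "Vok \<inter> Vbad = {}"
    and qi: "subjective_quorum_intersection Vok Vbad S"
    and ne: "subjective_intact Vok Vbad S \<noteq> {}"
  shows "subjective_intact Vok Vbad S \<subseteq> Vok"
    and "v \<in> Vok \<Longrightarrow> intact_quorum (Vok \<union> Vbad) (S v) (subjective_intact Vok Vbad S)"
proof -
  let ?V = "Vok \<union> Vbad"
  let ?P = "\<lambda>I. I \<subseteq> ?V \<and> I \<inter> Vbad = {} \<and> (I \<noteq> {} \<longrightarrow> (\<forall>v\<in>Vok. quorum ?V (S v) I)) \<and>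
    (\<forall>v\<in>Vok. quorum_intersection I (restrict_slices (S v) I))"
  have P_iff: "?P I \<longleftrightarrow> I = {} \<or> I \<subseteq> Vok \<and> I \<inter> Vbad = {} \<and> (\<forall>v\<in>Vok. intact_quorum ?V (S v) I)" for I
    by (auto simp: intact_quorum_def quorum_intersection_empty)
  have Un: "?P (X \<union> Y)" if "?P X" "?P Y" for X Y
    using that qi unfolding P_iff subjective_quorum_intersection_def
    by (auto intro: intact_quorum_Un)
  have empty: "?P {}"
    by (simp add: quorum_intersection_empty)
  have "?P (subjective_intact Vok Vbad S)"
    unfolding subjective_intact_def
    by (rule Greatest_Un_closed(1)[where P = ?P, OF assms(1) _ empty Un]) blast+
  then show "subjective_intact Vok Vbad S \<subseteq> Vok"
    and "v \<in> Vok \<Longrightarrow> intact_quorum ?V (S v) (subjective_intact Vok Vbad S)"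
    using ne unfolding P_iff by blast+
qed

section \<open>Bracha broadcast\<close>

text \<open>Views an action through the message it puts on the channels, which unites the two ready
  handlers. Recipients are left out because every message goes to all servers.\<close>

fun emits :: "'n \<Rightarrow> 'n \<Rightarrow> 'a msg \<Rightarrow> ('n, 'a) action \<Rightarrow> bool" where
  "emits c u m (Broadcast a) \<longleftrightarrow> u = c \<and> m = BCAST a"
| "emits c u m (Echo v a) \<longleftrightarrow> u = v \<and> m = ECHO a"
| "emits c u m (ReadyFromEcho v a) \<longleftrightarrow> u = v \<and> m = READY a"
| "emits c u m (ReadyFromReady v a) \<longleftrightarrow> u = v \<and> m = READY a"
| "emits c u m _ \<longleftrightarrow> False"

lemma emits_BCAST_iff: "emits c u (BCAST a) x \<longleftrightarrow> u = c \<and> x = Broadcast a"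
  by (cases x) auto

lemma emits_ECHO_iff: "emits c u (ECHO a) x \<longleftrightarrow> x = Echo u a"
  by (cases x) auto

lemma emits_READY_iff:
  "emits c u (READY a) x \<longleftrightarrow> x = ReadyFromEcho u a \<or> x = ReadyFromReady u a"
  by (cases x) auto

text \<open>Separates the protocol argument from slices. \<open>quorum_meets\<close> serves
  agreement, \<open>quorum_available\<close> progress, \<open>blocking_correct\<close> the tracing
  of \<open>READY\<close> messages back to echoes, and \<open>quorum_blocks\<close> the spread of
  readiness in totality.\<close>

locale bracha =
  fixes C Cok Vok Vbad :: "'n set" and c :: 'n and Q B :: "'n \<Rightarrow> 'n set set"
    and \<sigma> :: "nat \<Rightarrow> ('n, 'a) config" and \<alpha> :: "nat \<Rightarrow> ('n, 'a) action"
  assumes exec: "bracha_execution C Cok Vok Vbad c Q B \<sigma> \<alpha>"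
    and finite_servers: "finite (Vok \<union> Vbad)"
    and quorum_meets:
      "\<lbrakk>v \<in> Vok; v' \<in> Vok; U \<in> Q v; U' \<in> Q v'\<rbrakk> \<Longrightarrow> U \<inter> U' \<inter> Vok \<noteq> {}"
    and quorum_available: "v \<in> Vok \<Longrightarrow> \<exists>U\<in>Q v. U \<subseteq> Vok"
    and blocking_correct:
      "\<lbrakk>v \<in> Vok; W \<subseteq> Vok \<union> Vbad; \<forall>B'\<in>B v. \<not> W \<subseteq> B'\<rbrakk> \<Longrightarrow> W \<inter> Vok \<noteq> {}"
    and quorum_blocks:
      "\<lbrakk>v \<in> Vok; v' \<in> Vok; U \<in> Q v; B' \<in> B v'\<rbrakk> \<Longrightarrow> \<not> U \<inter> Vok \<subseteq> B'"
begin

abbreviation is_enabled :: "nat \<Rightarrow> ('n, 'a) action \<Rightarrow> bool" where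
  "is_enabled t \<equiv> enabled C Cok Vok Vbad c Q B (\<sigma> t)"

section \<open>Configurations as functions of the action history\<close>

lemma config_0: "\<sigma> 0 = initial_config"
  and config_Suc: "\<sigma> (Suc t) = perform (Vok \<union> Vbad) c (\<alpha> t) (\<sigma> t)"
  and action_enabled: "is_enabled t (\<alpha> t)"
  and fair: "h \<in> handlers Vok \<Longrightarrow> (\<And>t'. t' \<ge> t \<Longrightarrow> is_enabled t' h) \<Longrightarrow> \<exists>t'\<ge>t. \<alpha> t' = h"
  and reliable: "u \<in> Cok \<union> Vok \<Longrightarrow> v \<in> Vok \<Longrightarrow> (u, v, m) \<in> sent (\<sigma> t) \<Longrightarrow>
    \<exists>t'. (u, m) \<in> received (\<sigma> t') v"
  using exec unfolding bracha_execution_def by blast+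

text \<open>This and the next five lemmas replace state by past actions. The bound is strict because
  \<open>\<sigma> t\<close> is the configuration before the action
  \<open>\<alpha> t\<close>.\<close>

lemma sent_iff:
  "(u, w, m) \<in> sent (\<sigma> t) \<longleftrightarrow> w \<in> Vok \<union> Vbad \<and> (\<exists>t'<t. emits c u m (\<alpha> t'))"
proof (induction t)
  case (Suc t)
  then show ?case
    by (cases "\<alpha> t") (auto simp: config_Suc send_all_def less_Suc_eq)
qed (simp add: config_0 initial_config_def)

lemma received_iff: "(u, m) \<in> received (\<sigma> t) v \<longleftrightarrow> (\<exists>t'<t. \<alpha> t' = Receive u v m)"
proof (induction t)
  case (Suc t)
  then show ?case
    by (cases "\<alpha> t") (auto simp: config_Suc less_Suc_eq)
qed (simp add: config_0 initial_config_def)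

lemma has_bcast_iff: "has_bcast (\<sigma> t) \<longleftrightarrow> (\<exists>t'<t. \<exists>a. \<alpha> t' = Broadcast a)"
proof (induction t)
  case (Suc t)
  then show ?case
    by (cases "\<alpha> t") (auto simp: config_Suc less_Suc_eq)
qed (simp add: config_0 initial_config_def)

lemma echoed_iff: "echoed (\<sigma> t) v \<longleftrightarrow> (\<exists>t'<t. \<exists>a. \<alpha> t' = Echo v a)"
proof (induction t)
  case (Suc t)
  then show ?case
    by (cases "\<alpha> t") (auto simp: config_Suc less_Suc_eq)
qed (simp add: config_0 initial_config_def)

lemma ready_iff: "ready (\<sigma> t) v \<longleftrightarrow> (\<exists>t'<t. \<exists>a. emits c v (READY a) (\<alpha> t'))"
proof (induction t)
  case (Suc t)
  then show ?case
    by (cases "\<alpha> t") (auto simp: config_Suc less_Suc_eq)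
qed (simp add: config_0 initial_config_def)

lemma delivered_iff: "delivered (\<sigma> t) v \<longleftrightarrow> (\<exists>t'<t. \<exists>a. \<alpha> t' = Deliver v a)"
proof (induction t)
  case (Suc t)
  then show ?case
    by (cases "\<alpha> t") (auto simp: config_Suc less_Suc_eq)
qed (simp add: config_0 initial_config_def)

lemma received_mono: "(u, m) \<in> received (\<sigma> t) v \<Longrightarrow> t \<le> t' \<Longrightarrow> (u, m) \<in> received (\<sigma> t') v"
  unfolding received_iff by (meson less_le_trans)

text \<open>Authenticity: receipt from a correct node is enabled only after the sending. The strict
  decrease in time supports induction and fixes the order of events.\<close>

lemma received_emits:
  assumes "(u, m) \<in> received (\<sigma> t) v" "u \<in> Cok \<union> Vok"
  obtains t' where "t' < t" "emits c u m (\<alpha> t')"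
proof -
  obtain t1 where t1: "t1 < t" "\<alpha> t1 = Receive u v m"
    using assms(1) unfolding received_iff by blast
  then have "(u, v, m) \<in> sent (\<sigma> t1)"
    using action_enabled[of t1] assms(2) by auto
  then show ?thesis
    using that t1 unfolding sent_iff by (meson less_trans)
qed

lemma emits_received:
  assumes "emits c u m (\<alpha> t)" "u \<in> Cok \<union> Vok" "v \<in> Vok"
  shows "\<exists>t'. (u, m) \<in> received (\<sigma> t') v"
proof -
  have "(u, v, m) \<in> sent (\<sigma> (Suc t))"
    unfolding sent_iff using assms by blast
  then show ?thesis
    using reliable assms by blast
qed

lemma emits_all_received:
  assumes "U \<subseteq> Vok" "v \<in> Vok" "\<And>u. u \<in> U \<Longrightarrow> \<exists>t. emits c u m (\<alpha> t)"
  shows "\<exists>t. \<forall>u\<in>U. (u, m) \<in> received (\<sigma> t) v"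
proof -
  have "\<forall>u\<in>U. \<exists>t. (u, m) \<in> received (\<sigma> t) v"
    using assms emits_received by blast
  then obtain f where f: "\<And>u. u \<in> U \<Longrightarrow> (u, m) \<in> received (\<sigma> (f u)) v"
    by metis
  have "finite U"
    using assms(1) finite_servers by (meson finite_Un finite_subset)
  \<comment> \<open>Received messages persist, so the latest of the finitely many receipt times
    works for all of \<open>U\<close>. For empty \<open>U\<close> the \<open>Max\<close> is
    unspecified but nothing is claimed about it.\<close>
  then have "f u \<le> Max (f ` U)" if "u \<in> U" for u
    using that by simp
  with f show ?thesis
    using received_mono by blast
qed

section \<open>Guarded actions happen at most once\<close>

lemma Broadcast_unique:
  assumes "\<alpha> t = Broadcast a" "\<alpha> t' = Broadcast a'"
  shows "t = t'" "a = a'"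
proof -
  have "\<not> has_bcast (\<sigma> t)" "\<not> has_bcast (\<sigma> t')"
    using action_enabled[of t] action_enabled[of t'] assms by auto
  then show "t = t'"
    using assms unfolding has_bcast_iff by (meson linorder_neqE_nat)
  then show "a = a'"
    using assms by simp
qed

lemma Echo_unique:
  assumes "\<alpha> t = Echo v a" "\<alpha> t' = Echo v a'"
  shows "a = a'"
proof -
  have "\<not> echoed (\<sigma> t) v" "\<not> echoed (\<sigma> t') v"
    using action_enabled[of t] action_enabled[of t'] assms by auto
  then have "t = t'"
    using assms unfolding echoed_iff by (meson linorder_neqE_nat)
  then show ?thesis
    using assms by simp
qed

lemma Deliver_unique:
  assumes "\<alpha> t = Deliver v a" "\<alpha> t' = Deliver v a'"
  shows "t = t'" "a = a'"
proof -
  have "\<not> delivered (\<sigma> t) v" "\<not> delivered (\<sigma> t') v"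
    using action_enabled[of t] action_enabled[of t'] assms by auto
  then show "t = t'"
    using assms unfolding delivered_iff by (meson linorder_neqE_nat)
  then show "a = a'"
    using assms by simp
qed

section \<open>Progress from completeness\<close>

lemma eventually_Echo:
  assumes "v \<in> Vok" "(c, BCAST a) \<in> received (\<sigma> t) v"
  shows "\<exists>t' b. \<alpha> t' = Echo v b"
proof (rule ccontr)
  \<comment> \<open>If no echo ever occurs, the flag stays false and the handler for
    \<open>a\<close> stays enabled, so completeness executes it. The conclusion leaves the value
    \<open>b\<close> open, since an instance for another value may set the flag first. The next
    three lemmas follow the same pattern.\<close>
  assume never: "\<not> ?thesis"
  have "\<exists>t'\<ge>t. \<alpha> t' = Echo v a"
    by (rule fair) (use assms never received_mono in \<open>auto simp: handlers_def echoed_iff\<close>)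
  with never show False
    by blast
qed

lemma eventually_READY_from_ECHO:
  assumes "v \<in> Vok" "U \<in> Q v" "\<And>u. u \<in> U \<Longrightarrow> (u, ECHO a) \<in> received (\<sigma> t) v"
  shows "\<exists>t' b. emits c v (READY b) (\<alpha> t')"
proof (rule ccontr)
  assume never: "\<not> ?thesis"
  have "\<exists>t'\<ge>t. \<alpha> t' = ReadyFromEcho v a"
  proof (rule fair)
    fix t' assume "t \<le> t'"
    then have "\<forall>u\<in>U. (u, ECHO a) \<in> received (\<sigma> t') v"
      using assms(3) received_mono by blast
    then show "is_enabled t' (ReadyFromEcho v a)"
      using assms(1,2) never by (auto simp: ready_iff)
  qed (use assms(1) in \<open>auto simp: handlers_def\<close>)
  with never show False
    by (auto simp: emits_READY_iff)
qed

lemma eventually_READY_from_READY: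
  assumes "v \<in> Vok" "W \<subseteq> Vok \<union> Vbad" "W \<noteq> {}" "\<And>B'. B' \<in> B v \<Longrightarrow> \<not> W \<subseteq> B'"
    and "\<And>u. u \<in> W \<Longrightarrow> (u, READY a) \<in> received (\<sigma> t) v"
  shows "\<exists>t' b. emits c v (READY b) (\<alpha> t')"
proof (rule ccontr)
  assume never: "\<not> ?thesis"
  have "\<exists>t'\<ge>t. \<alpha> t' = ReadyFromReady v a"
  proof (rule fair)
    fix t' assume "t \<le> t'"
    then have "\<forall>u\<in>W. (u, READY a) \<in> received (\<sigma> t') v"
      using assms(5) received_mono by blast
    then show "is_enabled t' (ReadyFromReady v a)"
      using assms(1-4) never by (auto simp: ready_iff intro!: exI[of _ W])
  qed (use assms(1) in \<open>auto simp: handlers_def\<close>)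
  with never show False
    by (auto simp: emits_READY_iff)
qed

lemma eventually_Deliver:
  assumes "v \<in> Vok" "U \<in> Q v" "\<And>u. u \<in> U \<Longrightarrow> (u, READY a) \<in> received (\<sigma> t) v"
  shows "\<exists>t' b. \<alpha> t' = Deliver v b"
proof (rule ccontr)
  assume never: "\<not> ?thesis"
  have "\<exists>t'\<ge>t. \<alpha> t' = Deliver v a"
  proof (rule fair)
    fix t' assume "t \<le> t'"
    then have "\<forall>u\<in>U. (u, READY a) \<in> received (\<sigma> t') v"
      using assms(3) received_mono by blast
    then show "is_enabled t' (Deliver v a)"
      using assms(1,2) never by (auto simp: delivered_iff)
  qed (use assms(1) in \<open>auto simp: handlers_def\<close>)
  with never show False
    by blast
qed

section \<open>Tracing deliveries back to echoes and broadcasts\<close>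

lemma quorum_correct:
  assumes "v \<in> Vok" "U \<in> Q v"
  obtains u where "u \<in> U" "u \<in> Vok"
  using quorum_meets[OF assms(1) assms(1) assms(2) assms(2)] by blast

lemma Deliver_READY:
  assumes "\<alpha> t = Deliver v a"
  obtains u t' where "u \<in> Vok" "t' < t" "emits c u (READY a) (\<alpha> t')"
proof -
  obtain U where U: "v \<in> Vok" "U \<in> Q v" "\<forall>u\<in>U. (u, READY a) \<in> received (\<sigma> t) v"
    using action_enabled[of t] assms by auto
  then obtain u where "u \<in> U" "u \<in> Vok"
    using quorum_correct by blast
  with U that show ?thesis
    by (meson UnI2 received_emits)
qed

text \<open>The first correct server to send \<open>READY a\<close> cannot have done so because of other
  \<open>READY\<close> messages.\<close>

lemma READY_ECHO_quorum:
  assumes "emits c v (READY a) (\<alpha> t)"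
  shows "\<exists>w\<in>Vok. \<exists>U\<in>Q w. \<exists>t'\<le>t. \<forall>u\<in>U. (u, ECHO a) \<in> received (\<sigma> t') w"
  using assms
proof (induction t arbitrary: v rule: less_induct)
  case (less t)
  then consider "\<alpha> t = ReadyFromEcho v a" | "\<alpha> t = ReadyFromReady v a"
    by (auto simp: emits_READY_iff)
  then show ?case
  proof cases
    case 1
    then show ?thesis
      using action_enabled[of t] by auto
  next
    case 2
    then obtain W where W: "v \<in> Vok" "W \<subseteq> Vok \<union> Vbad" "\<forall>B'\<in>B v. \<not> W \<subseteq> B'"
      "\<forall>u\<in>W. (u, READY a) \<in> received (\<sigma> t) v"
      using action_enabled[of t] by auto
    then obtain u where "u \<in> W" "u \<in> Vok"
      using blocking_correct by blast
    with W obtain t' where "t' < t" "emits c u (READY a) (\<alpha> t')"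
      by (meson UnI2 received_emits)
    then show ?thesis
      using less.IH by (meson less_imp_le order_trans)
  qed
qed

text \<open>Both messages trace back to echo quorums, possibly in different views. These share a
  correct server, which echoed both values although it echoes only once.\<close>

lemma READY_unique:
  assumes "emits c v (READY a) (\<alpha> t)" "emits c v' (READY a') (\<alpha> t')"
  shows "a = a'"
proof -
  obtain w U s where 1: "w \<in> Vok" "U \<in> Q w" "\<forall>u\<in>U. (u, ECHO a) \<in> received (\<sigma> s) w"
    using READY_ECHO_quorum[OF assms(1)] by blast
  obtain w' U' s' where 2: "w' \<in> Vok" "U' \<in> Q w'" "\<forall>u\<in>U'. (u, ECHO a') \<in> received (\<sigma> s') w'"
    using READY_ECHO_quorum[OF assms(2)] by blast
  obtain u where "u \<in> U" "u \<in> U'" "u \<in> Vok"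
    using quorum_meets[OF 1(1) 2(1) 1(2) 2(2)] by blast
  then obtain r r' where "\<alpha> r = Echo u a" "\<alpha> r' = Echo u a'"
    using 1(3) 2(3) by (metis UnI2 emits_ECHO_iff received_emits)
  then show ?thesis
    by (rule Echo_unique)
qed

lemma Echo_Broadcast:
  assumes "\<alpha> t = Echo v a" "c \<in> Cok"
  obtains t' where "t' < t" "\<alpha> t' = Broadcast a"
proof -
  have "(c, BCAST a) \<in> received (\<sigma> t) v"
    using action_enabled[of t] assms by simp
  then show ?thesis
    using that assms(2) by (metis UnI1 emits_BCAST_iff received_emits)
qed

lemma READY_Broadcast:
  assumes "emits c v (READY a) (\<alpha> t)" "c \<in> Cok"
  obtains t' where "t' < t" "\<alpha> t' = Broadcast a"
proof -
  obtain w U s where U: "w \<in> Vok" "U \<in> Q w" "s \<le> t" "\<forall>u\<in>U. (u, ECHO a) \<in> received (\<sigma> s) w"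
    using READY_ECHO_quorum[OF assms(1)] by blast
  then obtain u where "u \<in> U" "u \<in> Vok"
    using quorum_correct by blast
  with U obtain r where "r < s" "\<alpha> r = Echo u a"
    by (metis UnI2 emits_ECHO_iff received_emits)
  with U(3) that show ?thesis
    by (meson Echo_Broadcast assms(2) less_le_trans less_trans)
qed

lemma all_READY_imp_Deliver:
  assumes "v \<in> Vok" "\<And>u. u \<in> Vok \<Longrightarrow> \<exists>t. emits c u (READY a) (\<alpha> t)"
  shows "\<exists>t b. \<alpha> t = Deliver v b"
proof -
  obtain U where U: "U \<in> Q v" "U \<subseteq> Vok"
    using quorum_available assms(1) by blast
  then obtain t where "\<forall>u\<in>U. (u, READY a) \<in> received (\<sigma> t) v"
    using emits_all_received[of U v "READY a"] assms by blast
  then show ?thesis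
    using eventually_Deliver U(1) assms(1) by blast
qed

section \<open>The five properties of an execution\<close>

lemma no_duplication: "no_duplication Vok \<alpha>"
  unfolding no_duplication_def using Deliver_unique by blast

lemma consistency: "consistency Vok \<alpha>"
  unfolding consistency_def by (metis Deliver_READY READY_unique)

lemma integrity: "integrity Cok Vok c \<alpha>"
  unfolding integrity_def by (meson Deliver_READY READY_Broadcast less_trans)

lemma validity: "validity Cok Vok c \<alpha>"
  unfolding validity_def
proof (intro impI allI ballI)
  fix t a v
  assume c: "c \<in> Cok" and t: "\<alpha> t = Broadcast a" and v: "v \<in> Vok"
  have echo: "\<exists>t'. emits c u (ECHO a) (\<alpha> t')" if u: "u \<in> Vok" for u
  proof -
    obtain t1 where "(c, BCAST a) \<in> received (\<sigma> t1) u"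
      using emits_received[of c "BCAST a" t u] t c u by auto
    then obtain t2 b where "\<alpha> t2 = Echo u b"
      using eventually_Echo u by blast
    moreover from this have "b = a"
      using Echo_Broadcast c t Broadcast_unique(2) by metis
    ultimately show ?thesis
      by (auto simp: emits_ECHO_iff)
  qed
  have ready: "\<exists>t'. emits c u (READY a) (\<alpha> t')" if u: "u \<in> Vok" for u
  proof -
    obtain U where U: "U \<in> Q u" "U \<subseteq> Vok"
      using quorum_available u by blast
    then obtain t1 where "\<forall>w\<in>U. (w, ECHO a) \<in> received (\<sigma> t1) u"
      using emits_all_received[of U u "ECHO a"] u echo by blast
    then obtain t2 b where "emits c u (READY b) (\<alpha> t2)"
      using eventually_READY_from_ECHO U(1) u by blast
    \<comment> \<open>Progress leaves the value open; tracing it back to the sender's only broadcast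
      fixes it.\<close>
    moreover from this have "b = a"
      using READY_Broadcast c t Broadcast_unique(2) by metis
    ultimately show ?thesis
      by blast
  qed
  obtain t' b where "\<alpha> t' = Deliver v b"
    using all_READY_imp_Deliver v ready by blast
  moreover from this obtain s where "s < t'" "\<alpha> s = Broadcast b"
    using integrity v c unfolding integrity_def by blast
  \<comment> \<open>The broadcast at \<open>s\<close> must be the one at \<open>t\<close>, which
    gives both the value and the order in time.\<close>
  ultimately show "\<exists>t'>t. \<alpha> t' = Deliver v a"
    using t Broadcast_unique by metis
qed

lemma totality: "totality Vok \<alpha>"
  unfolding totality_def
proof (intro ballI allI impI)
  fix v t a v'
  assume v: "v \<in> Vok" and t: "\<alpha> t = Deliver v a" and v': "v' \<in> Vok"
  obtain U where U: "U \<in> Q v" "\<forall>u\<in>U. (u, READY a) \<in> received (\<sigma> t) v"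
    using action_enabled[of t] t by auto
  have emitted: "\<exists>t'. emits c u (READY a) (\<alpha> t')" if "u \<in> U \<inter> Vok" for u
    using that U(2) by (metis IntD1 IntD2 UnI2 received_emits)
  have "\<exists>t'. emits c w (READY a) (\<alpha> t')" if w: "w \<in> Vok" for w
  proof -
    \<comment> \<open>Only the correct part of \<open>U\<close> is used: faulty members may have
      sent \<open>READY a\<close> to \<open>v\<close> and not to \<open>w\<close>.\<close>
    obtain t1 where "\<forall>u\<in>U \<inter> Vok. (u, READY a) \<in> received (\<sigma> t1) w"
      using emits_all_received[of "U \<inter> Vok" w "READY a"] w emitted by blast
    moreover have "U \<inter> Vok \<noteq> {}"
      using quorum_correct v U(1) by blast
    ultimately obtain t2 b where "emits c w (READY b) (\<alpha> t2)"
      using eventually_READY_from_READY[of w "U \<inter> Vok" a t1] quorum_blocks[OF v w U(1)] w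
      by blast
    moreover from this have "b = a"
      using READY_unique Deliver_READY[OF t] by metis
    ultimately show ?thesis
      by blast
  qed
  then show "\<exists>t' a'. \<alpha> t' = Deliver v' a'"
    using all_READY_imp_Deliver v' by blast
qed

end

section \<open>Instantiation with the induced quorum system\<close>

theorem corollary27:
  fixes C Cok Vok Vbad :: "'n set"
    and c :: 'n
    and S :: "'n \<Rightarrow> 'n \<Rightarrow> 'n set set"
    and Q B :: "'n \<Rightarrow> 'n set set"
  assumes "finite (Vok \<union> Vbad)" and "Vok \<union> Vbad \<noteq> {}" and "Vok \<inter> Vbad = {}"
    and "C \<inter> (Vok \<union> Vbad) = {}" and "Cok \<subseteq> C" and "c \<in> C"
    and "subjective_fbqs Vok Vbad S"
    and "subjective_quorum_intersection Vok Vbad S"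
    and "subjective_intact Vok Vbad S \<noteq> {}"
    and "\<And>v. v \<in> Vok \<Longrightarrow> Q v = induced_quorums (Vok \<union> Vbad) (S v)"
    and "\<And>v. v \<in> Vok \<Longrightarrow> B v = induced_fail_prone (Vok \<union> Vbad) (S v)"
  shows "implements_reliable_byzantine_broadcast Cok Vok c
           (bracha_traces C Cok Vok Vbad c Q B :: (nat \<Rightarrow> ('n, 'a) action) set)"
proof -
  let ?V = "Vok \<union> Vbad" and ?I = "subjective_intact Vok Vbad S"
  have I: "?I \<subseteq> Vok" and intact: "\<And>v. v \<in> Vok \<Longrightarrow> intact_quorum ?V (S v) ?I"
    using subjective_intact_props[OF assms(1,3,8,9)] by blast+
  have qi: "quorum_intersection ?V (S v)" if "v \<in> Vok" for v
    using assms(8) that by (simp add: subjective_quorum_intersection_def)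
  \<comment> \<open>Views share the slices of correct servers only, and intact servers are
    correct.\<close>
  have agree: "S v' u = S v u" if "v \<in> Vok" "v' \<in> Vok" "u \<in> ?I" for v v' u
    using assms(7) that I unfolding subjective_fbqs_def by blast
  have meets: "U \<inter> U' \<inter> ?I \<noteq> {}"
    if "v \<in> Vok" "v' \<in> Vok" "quorum ?V (S v) U" "quorum ?V (S v') U'" for v v' U U'
    using intact_quorum_meets[OF intact qi agree qi] that by blast
  have "bracha C Cok Vok Vbad c Q B \<sigma> \<alpha>"
    if "bracha_execution C Cok Vok Vbad c Q B \<sigma> \<alpha>"
    for \<sigma> and \<alpha> :: "nat \<Rightarrow> ('n, 'a) action"
  proof
    fix v v' U U'
    assume "v \<in> Vok" "v' \<in> Vok" "U \<in> Q v" "U' \<in> Q v'"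
    then have "U \<inter> U' \<inter> ?I \<noteq> {}"
      using meets assms(10) by (simp add: induced_quorums_def)
    then show "U \<inter> U' \<inter> Vok \<noteq> {}"
      using I by blast
  next
    fix v assume "v \<in> Vok"
    then have "?I \<in> Q v"
      using intact assms(10) by (simp add: induced_quorums_def intact_quorum_def)
    then show "\<exists>U\<in>Q v. U \<subseteq> Vok"
      using I by blast
  next
    fix v W
    assume v: "v \<in> Vok" and W: "W \<subseteq> ?V" "\<forall>B'\<in>B v. \<not> W \<subseteq> B'"
    obtain B' where "B' \<in> induced_fail_prone ?V (S v)" "?V - ?I \<subseteq> B'"
      using ex_induced_fail_prone_superset[OF assms(1) qi[OF v] intact[OF v]] .
    moreover from this have "B' \<in> B v"
      using assms(11) v by simp
    \<comment> \<open>The complement of \<open>?I\<close> lies inside a fail-prone set, so a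
      blocking set must contain an intact, hence correct, server.\<close>
    ultimately have "\<not> W \<subseteq> ?V - ?I"
      using W(2) by blast
    with W(1) I show "W \<inter> Vok \<noteq> {}"
      by blast
  next
    fix v v' U B'
    assume v: "v \<in> Vok" "v' \<in> Vok" and U: "U \<in> Q v" and B': "B' \<in> B v'"
    obtain J where J: "intact_quorum ?V (S v') J" "B' = ?V - J"
      using induced_fail_proneD[OF assms(1) qi[OF v(2)]] B' assms(11) v(2) by blast
    \<comment> \<open>\<open>J\<close>, the complement of the fail-prone set, is itself a quorum of
      the view of \<open>v'\<close>. The server it shares with \<open>U\<close> is correct and
      outside \<open>B'\<close>.\<close>
    have "U \<inter> J \<inter> ?I \<noteq> {}"
      using meets[OF v] U J(1) assms(10) v(1)
      by (simp add: induced_quorums_def intact_quorum_def)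
    then show "\<not> U \<inter> Vok \<subseteq> B'"
      using I J(2) by blast
  qed (use that assms(1) in blast)+
  then show ?thesis
    unfolding implements_reliable_byzantine_broadcast_def bracha_traces_def
    by (auto intro: bracha.validity bracha.no_duplication bracha.integrity bracha.consistency
        bracha.totality)
qed

end
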